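(* Let $\mathbb{K}$ be a field, let $m,n,p,q\ge 0$ be integers, let $E,H\in\mathbb{K}^{(m+n)\times(p+q)}$ and $E',H'\in\mathbb{K}^{m\times p}$. Then $(E,H)\succ(E',H')$ if and only if the Kronecker representation $(E',H')$ is a subfactor of the Kronecker representation $(E,H)$. In particular, the relation $\succ$ is a partial order on the set of all (isomorphism classes of) Kronecker representations.
   Context: A Kronecker representation over $\mathbb{K}$ is a tuple $M=(M(1),M(2);M(\alpha),M(\beta))$, also written $(M(\alpha),M(\beta))$, where $M(1),M(2)$ are finite-dimensional $\mathbb{K}$-vector spaces and $M(\alpha),M(\beta):M(1)\to M(2)$ are linear maps. A pair $(E,H)$ of matrices of the same size $r\times c$ is regarded as the Kronecker representation $(\mathbb{K}^{c},\mathbb{K}^{r};E,H)$. A homomorphism $N\to M$ is a pair of linear maps $(\phi,\psi)$, $\phi:N(1)\to M(1)$, $\psi:N(2)\to M(2)$, with $M(\alpha)\phi=\psi N(\alpha)$ and $M(\beta)\phi=\psi N(\beta)$. It is a monomorphism (epimorphism, isomorphism) if both $\phi$ and $\psi$ are injective (surjective, bijective). Subrepresentations are considered up to isomorphism: $N$ is a subrepresentation of $M$ if there is a monomorphism $N\to M$; $N$ is a factor representation of $M$ if there is an epimorphism $M\to N$. A subfactor of $M$ is a factor representation of a subrepresentation of $M$. The relation $(E,H)\succ(E',H')$ means: there exist matrices $E_{12},H_{12}\in\mathbb{K}^{m\times q}$, $E_{21},H_{21}\in\mathbb{K}^{n\times p}$, $E_{22},H_{22}\in\mathbb{K}^{n\times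 q}$ such that $(E,H)$ is isomorphic, as a Kronecker representation, to $$\left(\left[\begin{array}{cc} E' & E_{12} \\ E_{21} & E_{22} \end{array}\right],\left[\begin{array}{cc} H' & H_{12} \\ H_{21} & H_{22} \end{array}\right]\right).$$ This relation depends only on the isomorphism classes of $(E,H)$ and $(E',H')$. (For $(E,H)\succ(E',H')$ it is required in particular that the size of $E'$ is at most that of $E$ in both dimensions.) *)

theory Defs
  imports "Jordan_Normal_Form.VS_Connect" "HOL.Order_Relation"
begin

text \<open>
  The ground field is a type of class \<^class>\<open>field\<close>, used through \<^term>\<open>class_ring\<close>. The two vector
  spaces are arbitrary modules over it with explicit carriers, so the zero space is allowed.
\<close>

record ('k, 'v, 'w) kronecker =
  space1 :: "('k, 'v) module"
  space2 :: "('k, 'w) module"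
  map_alpha :: "'v \<Rightarrow> 'w"
  map_beta :: "'v \<Rightarrow> 'w"

definition kronecker_rep :: "('k :: field, 'v, 'w) kronecker \<Rightarrow> bool" where
  "kronecker_rep M \<longleftrightarrow>
     vectorspace class_ring (space1 M) \<and> vectorspace.fin_dim class_ring (space1 M) \<and>
     vectorspace class_ring (space2 M) \<and> vectorspace.fin_dim class_ring (space2 M) \<and>
     linear_map class_ring (space1 M) (space2 M) (map_alpha M) \<and>
     linear_map class_ring (space1 M) (space2 M) (map_beta M)"

definition kronecker_hom ::
  "('k :: field, 'v, 'w) kronecker \<Rightarrow> ('k, 'x, 'y) kronecker \<Rightarrow> ('v \<Rightarrow> 'x) \<Rightarrow> ('w \<Rightarrow> 'y) \<Rightarrow> bool" where
  "kronecker_hom N M \<phi> \<psi> \<longleftrightarrow>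
     linear_map class_ring (space1 N) (space1 M) \<phi> \<and>
     linear_map class_ring (space2 N) (space2 M) \<psi> \<and>
     (\<forall>x \<in> carrier (space1 N). map_alpha M (\<phi> x) = \<psi> (map_alpha N x)) \<and>
     (\<forall>x \<in> carrier (space1 N). map_beta M (\<phi> x) = \<psi> (map_beta N x))"

definition kronecker_mono ::
  "('k :: field, 'v, 'w) kronecker \<Rightarrow> ('k, 'x, 'y) kronecker \<Rightarrow> ('v \<Rightarrow> 'x) \<Rightarrow> ('w \<Rightarrow> 'y) \<Rightarrow> bool" where
  "kronecker_mono N M \<phi> \<psi> \<longleftrightarrow> kronecker_hom N M \<phi> \<psi> \<and>
     inj_on \<phi> (carrier (space1 N)) \<and> inj_on \<psi> (carrier (space2 N))"

definition kronecker_epi ::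
  "('k :: field, 'v, 'w) kronecker \<Rightarrow> ('k, 'x, 'y) kronecker \<Rightarrow> ('v \<Rightarrow> 'x) \<Rightarrow> ('w \<Rightarrow> 'y) \<Rightarrow> bool" where
  "kronecker_epi N M \<phi> \<psi> \<longleftrightarrow> kronecker_hom N M \<phi> \<psi> \<and>
     \<phi> ` carrier (space1 N) = carrier (space1 M) \<and> \<psi> ` carrier (space2 N) = carrier (space2 M)"

definition kronecker_iso ::
  "('k :: field, 'v, 'w) kronecker \<Rightarrow> ('k, 'x, 'y) kronecker \<Rightarrow> ('v \<Rightarrow> 'x) \<Rightarrow> ('w \<Rightarrow> 'y) \<Rightarrow> bool" where
  "kronecker_iso N M \<phi> \<psi> \<longleftrightarrow> kronecker_hom N M \<phi> \<psi> \<and>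
     bij_betw \<phi> (carrier (space1 N)) (carrier (space1 M)) \<and>
     bij_betw \<psi> (carrier (space2 N)) (carrier (space2 M))"

definition isomorphic ::
  "('k :: field, 'v, 'w) kronecker \<Rightarrow> ('k, 'x, 'y) kronecker \<Rightarrow> bool" where
  "isomorphic N M \<longleftrightarrow> (\<exists>\<phi> \<psi>. kronecker_iso N M \<phi> \<psi>)"

definition subrepresentation ::
  "('k :: field, 'v, 'w) kronecker \<Rightarrow> ('k, 'x, 'y) kronecker \<Rightarrow> bool" where
  "subrepresentation N M \<longleftrightarrow> (\<exists>\<phi> \<psi>. kronecker_mono N M \<phi> \<psi>)"

definition factor_representation ::
  "('k :: field, 'v, 'w) kronecker \<Rightarrow> ('k, 'x, 'y) kronecker \<Rightarrow> bool" where
  "factor_representation N M \<longleftrightarrow> (\<exists>\<phi> \<psi>. kronecker_epi M N \<phi> \<psi>)"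

text \<open>
  The intermediate representation \<open>N\<close> may be taken on the element types of \<open>M\<close> without loss of
  generality: whatever embeds into \<open>M\<close> is isomorphic to its image there.
\<close>

definition subfactor ::
  "('k :: field, 'v, 'w) kronecker \<Rightarrow> ('k, 'x, 'y) kronecker \<Rightarrow> bool" where
  "subfactor L M \<longleftrightarrow>
     (\<exists>N :: ('k, 'x, 'y) kronecker.
        kronecker_rep N \<and> subrepresentation N M \<and> factor_representation L N)"

definition matrix_rep ::
  "'k :: field mat \<Rightarrow> 'k mat \<Rightarrow> ('k, 'k vec, 'k vec) kronecker" where
  "matrix_rep E H =
     \<lparr> space1 = module_vec TYPE('k) (dim_col E), space2 = module_vec TYPE('k) (dim_row E),
       map_alpha = (\<lambda>v. E *\<^sub>v v), map_beta = (\<lambda>v. H *\<^sub>v v) \<rparr>"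

text \<open>
  The numbers \<open>m, n, p, q\<close> are determined by the sizes of the matrices.
\<close>

definition matrix_succ ::
  "'k :: field mat \<Rightarrow> 'k mat \<Rightarrow> 'k mat \<Rightarrow> 'k mat \<Rightarrow> bool" where
  "matrix_succ E H E' H' \<longleftrightarrow>
     (\<exists>m n p q E12 H12 E21 H21 E22 H22.
        E \<in> carrier_mat (m + n) (p + q) \<and> H \<in> carrier_mat (m + n) (p + q) \<and>
        E' \<in> carrier_mat m p \<and> H' \<in> carrier_mat m p \<and>
        E12 \<in> carrier_mat m q \<and> H12 \<in> carrier_mat m q \<and>
        E21 \<in> carrier_mat n p \<and> H21 \<in> carrier_mat n p \<and>
        E22 \<in> carrier_mat n q \<and> H22 \<in> carrier_mat n q \<and>
        isomorphic (matrix_rep E H)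
          (matrix_rep (four_block_mat E' E12 E21 E22) (four_block_mat H' H12 H21 H22)))"

text \<open>
  Every Kronecker representation is isomorphic to a matrix pair by a choice of bases; this is how
  the relation is transported to arbitrary representations.
\<close>

definition kronecker_succ ::
  "('k :: field, 'v, 'w) kronecker \<Rightarrow> ('k, 'x, 'y) kronecker \<Rightarrow> bool" where
  "kronecker_succ M N \<longleftrightarrow>
     (\<exists>E H E' H'. isomorphic M (matrix_rep E H) \<and> isomorphic N (matrix_rep E' H') \<and>
        matrix_succ E H E' H')"

definition iso_rel :: "('k :: field, 'v, 'w) kronecker rel" where
  "iso_rel = {(M, N). kronecker_rep M \<and> kronecker_rep N \<and> isomorphic M N}"

text \<open>
  The classes of representations whose spaces have elements in \<open>'v\<close> and \<open>'w\<close>. For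
  \<open>'v = 'w = 'k vec\<close> every isomorphism type of Kronecker representations occurs.
\<close>

definition iso_classes :: "('k :: field, 'v, 'w) kronecker set set" where
  "iso_classes = {M. kronecker_rep M} // iso_rel"

definition succ_rel :: "('k :: field, 'v, 'w) kronecker set rel" where
  "succ_rel = {(X, Y). X \<in> iso_classes \<and> Y \<in> iso_classes \<and> (\<exists>M \<in> X. \<exists>N \<in> Y. kronecker_succ M N)}"

lemma fin_dim_module_vec:
  "vectorspace.fin_dim class_ring (module_vec TYPE('k :: field) n)"
proof -
  interpret vec_space "TYPE('k)" n .
  show ?thesis by (rule fin_dim)
qed

lemma linear_map_mult_mat_vec:
  fixes A :: "'k :: field mat"
  assumes A: "A \<in> carrier_mat r c"
  shows "linear_map class_ring (module_vec TYPE('k) c) (module_vec TYPE('k) r) (\<lambda>v. A *\<^sub>v v)"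
proof -
  have "(\<lambda>v. A *\<^sub>v v) \<in> LinearCombinations.module_hom class_ring (module_vec TYPE('k) c) (module_vec TYPE('k) r)"
    using A unfolding LinearCombinations.module_hom_def
    by (auto simp: module_vec_simps mult_add_distrib_mat_vec mult_mat_vec)
  then show ?thesis
    unfolding linear_map_def mod_hom_def mod_hom_axioms_def
    using vec_vs vec_module by blast
qed

lemma kronecker_rep_matrix_rep:
  assumes "E \<in> carrier_mat r c" "H \<in> carrier_mat r c"
  shows "kronecker_rep (matrix_rep E H)"
  using assms linear_map_mult_mat_vec[OF assms(1)] linear_map_mult_mat_vec[OF assms(2)]
  unfolding kronecker_rep_def matrix_rep_def
  by (auto simp: vec_vs fin_dim_module_vec)

lemma linear_map_altdef:
  "linear_map K V W f \<longleftrightarrow>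
     vectorspace K V \<and> vectorspace K W \<and> f \<in> LinearCombinations.module_hom K V W"
  unfolding linear_map_def mod_hom_def mod_hom_axioms_def vectorspace_def by blast

lemma linear_map_comp:
  assumes "linear_map K U V f" "linear_map K V W g"
  shows "linear_map K U W (g \<circ> f)"
  using assms unfolding linear_map_altdef LinearCombinations.module_hom_def
  by (auto simp: Pi_iff)

lemma linear_map_the_inv_into:
  assumes f: "linear_map K V W f" and b: "bij_betw f (carrier V) (carrier W)"
  shows "linear_map K W V (the_inv_into (carrier V) f)"
proof -
  let ?g = "the_inv_into (carrier V) f"
  interpret linear_map K V W f by (rule f)
  have inj: "inj_on f (carrier V)" and im: "f ` carrier V = carrier W"
    using b by (auto simp: bij_betw_def)
  have g: "?g y \<in> carrier V" "f (?g y) = y" if "y \<in> carrier W" for y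
    using that inj im by (auto simp: the_inv_into_into f_the_inv_into_f)
  have eq: "?g y = x" if "x \<in> carrier V" "f x = y" for x y
    using that inj by (auto simp: the_inv_into_f_f)
  have "?g (y \<oplus>\<^bsub>W\<^esub> z) = ?g y \<oplus>\<^bsub>V\<^esub> ?g z" if "y \<in> carrier W" "z \<in> carrier W" for y z
    by (rule eq) (use that g in auto)
  moreover have "?g (r \<odot>\<^bsub>W\<^esub> y) = r \<odot>\<^bsub>V\<^esub> ?g y" if "r \<in> carrier K" "y \<in> carrier W" for r y
    by (rule eq) (use that g in auto)
  ultimately show ?thesis
    using f g unfolding linear_map_altdef LinearCombinations.module_hom_def by auto
qed

lemma isomorphic_refl:
  assumes "kronecker_rep M"
  shows "isomorphic M M"
proof -
  have "kronecker_iso M M id id"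
    using assms
    unfolding kronecker_rep_def kronecker_iso_def kronecker_hom_def linear_map_altdef
      LinearCombinations.module_hom_def
    by auto
  then show ?thesis unfolding isomorphic_def by blast
qed

lemma isomorphic_trans:
  assumes "isomorphic L M" "isomorphic M N"
  shows "isomorphic L N"
proof -
  obtain f g f' g' where 1: "kronecker_iso L M f g" and 2: "kronecker_iso M N f' g'"
    using assms unfolding isomorphic_def by blast
  have "f x \<in> carrier (space1 M)" if "x \<in> carrier (space1 L)" for x
    using 1 that unfolding kronecker_iso_def by (auto dest: bij_betwE)
  then have "kronecker_iso L N (f' \<circ> f) (g' \<circ> g)"
    using 1 2 unfolding kronecker_iso_def kronecker_hom_def
    by (auto intro: linear_map_comp bij_betw_trans)
  then show ?thesis unfolding isomorphic_def by blast
qed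

lemma isomorphic_sym:
  assumes M: "kronecker_rep M" and "isomorphic M N"
  shows "isomorphic N M"
proof -
  obtain f g where "kronecker_iso M N f g"
    using assms unfolding isomorphic_def by blast
  then have f: "linear_map class_ring (space1 M) (space1 N) f"
    and g: "linear_map class_ring (space2 M) (space2 N) g"
    and bf: "bij_betw f (carrier (space1 M)) (carrier (space1 N))"
    and bg: "bij_betw g (carrier (space2 M)) (carrier (space2 N))"
    and comm: "\<And>x. x \<in> carrier (space1 M) \<Longrightarrow> map_alpha N (f x) = g (map_alpha M x)"
      "\<And>x. x \<in> carrier (space1 M) \<Longrightarrow> map_beta N (f x) = g (map_beta M x)"
    unfolding kronecker_iso_def kronecker_hom_def by auto
  let ?f = "the_inv_into (carrier (space1 M)) f" and ?g = "the_inv_into (carrier (space2 M)) g"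
  have maps: "map_alpha M x \<in> carrier (space2 M)" "map_beta M x \<in> carrier (space2 M)"
    if "x \<in> carrier (space1 M)" for x
    using M that
    unfolding kronecker_rep_def linear_map_altdef LinearCombinations.module_hom_def by auto
  have fx: "?f y \<in> carrier (space1 M)" "f (?f y) = y" if "y \<in> carrier (space1 N)" for y
    using that bf by (auto simp: bij_betw_def the_inv_into_into f_the_inv_into_f)
  have gx: "?g (g x) = x" if "x \<in> carrier (space2 M)" for x
    using that bg by (auto simp: bij_betw_def the_inv_into_f_f)
  have "map_alpha M (?f y) = ?g (map_alpha N y)" "map_beta M (?f y) = ?g (map_beta N y)"
    if "y \<in> carrier (space1 N)" for y
    using fx[OF that] comm[of "?f y"] maps[of "?f y"] gx by metis+
  then have "kronecker_iso N M ?f ?g"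
    unfolding kronecker_iso_def kronecker_hom_def
    using linear_map_the_inv_into[OF f bf] linear_map_the_inv_into[OF g bg]
      bij_betw_the_inv_into[OF bf] bij_betw_the_inv_into[OF bg] by blast
  then show ?thesis unfolding isomorphic_def by blast
qed

lemma equiv_iso_rel:
  "equiv {M :: ('k :: field, 'v, 'w) kronecker. kronecker_rep M} iso_rel"
  unfolding equiv_def refl_on_def sym_def trans_def iso_rel_def
  by (auto intro: isomorphic_refl isomorphic_sym isomorphic_trans)

end

theory Submission
  imports Defs "Jordan_Normal_Form.DL_Rank"
begin

text \<open>
  Both \<open>\<succ>\<close> and the subfactor relation describe the same thing, here called a
  compression of \<open>M\<close> to \<open>N\<close>: an injective linear map \<open>i : N(1) \<rightarrow> M(1)\<close> and a surjective linear
  map \<open>r : M(2) \<rightarrow> N(2)\<close> such that \<open>r M(\<alpha>) i = N(\<alpha>)\<close> and \<open>r M(\<beta>) i = N(\<beta>)\<close>.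

  Suppose that \<open>L\<close> embeds into \<open>M\<close> and maps onto \<open>N\<close>. A linear retraction of \<open>L(2) \<rightarrow> M(2)\<close> turns
  the embedding into a compression of \<open>M\<close> to \<open>L\<close>, and a linear section of \<open>L(1) \<rightarrow> N(1)\<close> turns the
  epimorphism into a compression of \<open>L\<close> to \<open>N\<close>; compressions compose. Conversely, a compression
  factors through the subrepresentation with spaces \<open>i(N(1))\<close> and \<open>M(2)\<close>. This is
  \<open>subfactor_iff_compression\<close>.

  An upper left block is a compression by a coordinate inclusion and a coordinate projection.
  Conversely, the matrix of \<open>i\<close> can be completed by columns, and that of \<open>r\<close> by rows, to invertible
  matrices, and the resulting base change exhibits \<open>N\<close> as an upper left block of \<open>M\<close>. This is
  \<open>four_block_compression\<close> and \<open>compression_imp_matrix_succ\<close>; it rests on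
  \<open>inj_mat_extends_to_invertible\<close>.

  The partial order is then a statement about compressions. Reflexivity and transitivity are
  immediate. If \<open>M\<close> and \<open>N\<close> compress to each other, the spaces have equal dimensions, so \<open>i\<close> and
  \<open>r\<close> are bijective and give an isomorphism (\<open>compression_antisym\<close>).
\<close>

section \<open>Linear maps and coordinates\<close>

lemma carrier_module_vec [simp]: "carrier (module_vec TYPE('k :: field) n) = carrier_vec n"
  by (simp add: module_vec_simps)

lemma linear_mapD:
  assumes "linear_map K V W f"
  shows "\<And>x. x \<in> carrier V \<Longrightarrow> f x \<in> carrier W"
    and "\<And>x y. x \<in> carrier V \<Longrightarrow> y \<in> carrier V \<Longrightarrow> f (x \<oplus>\<^bsub>V\<^esub> y) = f x \<oplus>\<^bsub>W\<^esub> f y"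
    and "\<And>a x. a \<in> carrier K \<Longrightarrow> x \<in> carrier V \<Longrightarrow> f (a \<odot>\<^bsub>V\<^esub> x) = a \<odot>\<^bsub>W\<^esub> f x"
  using assms unfolding linear_map_altdef LinearCombinations.module_hom_def by auto

lemma linear_mapI:
  assumes "vectorspace K V" "vectorspace K W"
    and "\<And>x. x \<in> carrier V \<Longrightarrow> f x \<in> carrier W"
    and "\<And>x y. x \<in> carrier V \<Longrightarrow> y \<in> carrier V \<Longrightarrow> f (x \<oplus>\<^bsub>V\<^esub> y) = f x \<oplus>\<^bsub>W\<^esub> f y"
    and "\<And>a x. a \<in> carrier K \<Longrightarrow> x \<in> carrier V \<Longrightarrow> f (a \<odot>\<^bsub>V\<^esub> x) = a \<odot>\<^bsub>W\<^esub> f x"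
  shows "linear_map K V W f"
  using assms unfolding linear_map_altdef LinearCombinations.module_hom_def by auto

lemma linear_map_id: "vectorspace K V \<Longrightarrow> linear_map K V V id"
  by (rule linear_mapI) auto

text \<open>
  The basis criterion says that taking linear combinations of a basis \<open>B\<close> is a bijection from
  the space of functions on \<open>B\<close> onto \<open>V\<close>. Numbering \<open>B\<close> turns these functions into vectors.
\<close>

lemma coordinates:
  fixes V :: "('k :: field, 'v) module"
  assumes V: "vectorspace class_ring V" and fd: "vectorspace.fin_dim class_ring V"
  obtains n c where "linear_map class_ring V (module_vec TYPE('k) n) c"
    "bij_betw c (carrier V) (carrier_vec n)"
proof -
  interpret V: vectorspace class_ring V by (rule V)
  from V.finite_basis_exists[OF fd] obtain B where B: "finite B" "V.basis B" by blast
  then have BV: "B \<subseteq> carrier V" by (simp add: V.basis_def)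
  obtain bs where bs: "set bs = B" "distinct bs" using finite_distinct_list[OF B(1)] by blast
  let ?n = "length bs"
  define pos where "pos b = (THE i. i < ?n \<and> bs ! i = b)" for b
  have pos_nth: "pos (bs ! i) = i" if "i < ?n" for i
    unfolding pos_def using that bs(2) by (auto simp: nth_eq_iff_index_eq)
  have pos: "pos b < ?n" "bs ! pos b = b" if "b \<in> B" for b
    using that bs pos_nth by (metis in_set_conv_nth)+
  let ?F = "ring.func_space (class_ring :: 'k ring) B"
  let ?u = "\<lambda>v :: 'k vec. restrict (\<lambda>b. v $ pos b) B"
  have F: "vectorspace class_ring ?F" by (rule V.func_space_is_vs)
  have u_lin: "linear_map class_ring (module_vec TYPE('k) ?n) ?F ?u"
    by (rule linear_mapI) (use F vec_vs pos in \<open>auto simp: class_ring.func_space_def module_vec_simps\<close>)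
  have u_bij: "bij_betw ?u (carrier_vec ?n) (carrier ?F)"
  proof (rule bij_betwI[where g = "\<lambda>a. vec ?n (\<lambda>i. a (bs ! i))"])
    show "?u \<in> carrier_vec ?n \<rightarrow> carrier ?F" by (auto simp: class_ring.func_space_def)
  qed (use bs pos pos_nth nth_mem[of _ bs] in \<open>auto simp: class_ring.func_space_def PiE_iff extensional_def fun_eq_iff\<close>)
  let ?l = "\<lambda>a. V.lincomb a B"
  have l_lin: "linear_map class_ring ?F V ?l" by (rule V.lincomb_is_linear[OF B(1) BV])
  have ex1: "\<exists>!a. a \<in> carrier ?F \<and> ?l a = v" if "v \<in> carrier V" for v
    using B that V.basis_criterion[OF B(1) BV] by (simp add: class_ring.func_space_def)
  have l_bij: "bij_betw ?l (carrier ?F) (carrier V)"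
    using ex1 linear_mapD(1)[OF l_lin] unfolding bij_betw_def inj_on_def image_def by blast
  have lin: "linear_map class_ring (module_vec TYPE('k) ?n) V (?l \<circ> ?u)"
    by (rule linear_map_comp[OF u_lin l_lin])
  have bij: "bij_betw (?l \<circ> ?u) (carrier (module_vec TYPE('k) ?n)) (carrier V)"
    using bij_betw_trans[OF u_bij l_bij] by simp
  show ?thesis
    using that[OF linear_map_the_inv_into[OF lin bij]] bij_betw_the_inv_into[OF bij]
    by (simp only: carrier_module_vec)
qed

lemma linear_map_module_vec_eq_mult_mat_vec:
  fixes f :: "'k :: field vec \<Rightarrow> 'k vec"
  assumes f: "linear_map class_ring (module_vec TYPE('k) c) (module_vec TYPE('k) r) f"
  obtains A where "A \<in> carrier_mat r c" "\<And>v. v \<in> carrier_vec c \<Longrightarrow> f v = A *\<^sub>v v"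
proof -
  define A where "A = mat r c (\<lambda>(i, j). f (unit_vec c j) $ i)"
  have A: "A \<in> carrier_mat r c" by (simp add: A_def)
  have fcl: "f x \<in> carrier_vec r" if "x \<in> carrier_vec c" for x
    using linear_mapD(1)[OF f, of x] that by simp
  have fadd: "f (x + y) = f x + f y" if "x \<in> carrier_vec c" "y \<in> carrier_vec c" for x y
    using linear_mapD(2)[OF f, of x y] that by (simp add: module_vec_simps)
  have fsm: "f (a \<cdot>\<^sub>v x) = a \<cdot>\<^sub>v f x" if "x \<in> carrier_vec c" for x a
    using linear_mapD(3)[OF f, of a x] that by (simp add: module_vec_simps)
  have col: "f (unit_vec c j) = A *\<^sub>v unit_vec c j" if "j < c" for j
    using that fcl[of "unit_vec c j"] A by (intro eq_vecI) (auto simp: A_def)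
  \<comment> \<open>Truncations of \<open>v\<close> to its first \<open>k\<close> entries: each step adds a multiple of a unit vector.\<close>
  have "f (vec c (\<lambda>j. if j < k then v $ j else 0)) = A *\<^sub>v vec c (\<lambda>j. if j < k then v $ j else 0)"
    if "k \<le> c" for v k
    using that
  proof (induction k)
    case 0
    have z: "vec c (\<lambda>j. if j < 0 then v $ j else 0) = 0 \<cdot>\<^sub>v 0\<^sub>v c" by auto
    show ?case unfolding z using fsm[of "0\<^sub>v c" 0] fcl[of "0\<^sub>v c"] A
      by (simp add: mult_mat_vec) (auto simp: A_def intro!: eq_vecI)
  next
    case (Suc k)
    let ?w = "vec c (\<lambda>j. if j < k then v $ j else 0)"
    have s: "vec c (\<lambda>j. if j < Suc k then v $ j else 0) = ?w + v $ k \<cdot>\<^sub>v unit_vec c k"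
      using Suc.prems by (auto simp: less_Suc_eq)
    show ?case unfolding s
      using Suc A col[of k] by (simp add: fadd fsm mult_add_distrib_mat_vec mult_mat_vec)
  qed
  from this[OF order_refl] have "f v = A *\<^sub>v v" if "v \<in> carrier_vec c" for v
  proof -
    have "vec c (\<lambda>j. if j < c then v $ j else 0) = v" using that by auto
    with \<open>\<And>v. f (vec c (\<lambda>j. if j < c then v $ j else 0)) = _ v\<close> show ?thesis by metis
  qed
  with A show ?thesis by (rule that)
qed

section \<open>One-sided inverses of matrices and linear maps\<close>

text \<open>
  The columns of the right inverse are preimages of the unit vectors.
\<close>

lemma surj_mat_right_inverse:
  fixes R :: "'k :: field mat"
  assumes R: "R \<in> carrier_mat m n" and surj: "(\<lambda>v. R *\<^sub>v v) ` carrier_vec n = carrier_vec m"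
  obtains S where "S \<in> carrier_mat n m" "R * S = 1\<^sub>m m"
proof -
  have "\<exists>x \<in> carrier_vec n. R *\<^sub>v x = unit_vec m j" for j
    using surj by (metis imageE unit_vec_carrier)
  then obtain x where x: "\<And>j. x j \<in> carrier_vec n" "\<And>j. R *\<^sub>v x j = unit_vec m j" by metis
  define S where "S = mat_of_cols n (map x [0..<m])"
  have S: "S \<in> carrier_mat n m"
    using mat_of_cols_carrier(1)[of n "map x [0..<m]"] by (simp add: S_def)
  have "col (R * S) j = col (1\<^sub>m m) j" if "j < m" for j
  proof -
    have "col (R * S) j = R *\<^sub>v col S j" by (rule col_mult2[OF R S that])
    also have "col S j = x j" using that x(1) by (simp add: S_def)
    also have "R *\<^sub>v x j = unit_vec m j" by (rule x(2))
    also have "\<dots> = col (1\<^sub>m m) j" using that by simp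
    finally show ?thesis .
  qed
  then have "R * S = 1\<^sub>m m" using R S by (intro mat_col_eqI) auto
  with S show ?thesis by (rule that)
qed

text \<open>
  The columns of \<open>J\<close> are distinct and linearly independent, so they extend to a basis of the
  space of column vectors. This is the step that creates the blocks \<open>E12\<close>, \<open>E21\<close>, \<open>E22\<close> below:
  a compression only knows the first columns of one base change and the first rows of another.
\<close>

lemma inj_mat_extends_to_invertible:
  fixes J :: "'k :: field mat"
  assumes J: "J \<in> carrier_mat n p" and inj: "inj_on (\<lambda>v. J *\<^sub>v v) (carrier_vec p)"
  obtains P P' where "p \<le> n" "P \<in> carrier_mat n n" "P' \<in> carrier_mat n n"
    "P * P' = 1\<^sub>m n" "P' * P = 1\<^sub>m n" "\<And>j. j < p \<Longrightarrow> col P j = col J j"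
proof -
  interpret vec_space "TYPE('k)" n .
  have unit: "J *\<^sub>v unit_vec p j = col J j" if "j < p" for j
    using J that by (intro eq_vecI) auto
  have dist: "distinct (cols J)"
  proof (unfold distinct_conv_nth, intro allI impI)
    fix i j assume ij: "i < length (cols J)" "j < length (cols J)" "i \<noteq> j"
    then have "unit_vec p i \<noteq> (unit_vec p j :: 'k vec)"
      using J by (metis carrier_matD(2) cols_length index_unit_vec(1) zero_neq_one)
    then have "J *\<^sub>v unit_vec p i \<noteq> J *\<^sub>v unit_vec p j"
      using inj by (metis inj_onD unit_vec_carrier)
    then show "cols J ! i \<noteq> cols J ! j" using ij J unit by simp
  qed
  have li: "lin_indpt (set (cols J))"
  proof
    assume "lin_dep (set (cols J))"
    then obtain v where v: "v \<in> carrier_vec p" "v \<noteq> 0\<^sub>v p" "J *\<^sub>v v = 0\<^sub>v n"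
      by (rule lin_depE[OF J _ dist])
    have "J *\<^sub>v 0\<^sub>v p = 0\<^sub>v n" using J by (intro eq_vecI) auto
    with v inj show False by (metis inj_onD zero_carrier_vec)
  qed
  \<comment> \<open>A basis containing the columns is a maximal independent set above them.\<close>
  define ext where "ext T \<longleftrightarrow> T \<subseteq> carrier_vec n \<and> lin_indpt T \<and> set (cols J) \<subseteq> T" for T
  have bound: "finite T \<and> card T \<le> dim" if "ext T" for T
    using that li_le_dim[OF fin_dim, of T] by (simp add: ext_def)
  have "ext (set (cols J))" using li cols_dim[of J] J by (simp add: ext_def)
  then have "\<exists>B. finite B \<and> maximal B ext"
    using maximal_exists[of ext dim "set (cols J)"] bound by blast
  then obtain B where B: "finite B" "maximal B ext" by blast
  then have sub: "set (cols J) \<subseteq> B" "B \<subseteq> carrier_vec n" and liB: "lin_indpt B"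
    unfolding maximal_def ext_def by auto
  have "T = B" if T: "B \<subseteq> T" "T \<subseteq> carrier_vec n" "lin_indpt T" for T
  proof -
    have "ext T" unfolding ext_def using T sub(1) by simp
    with T(1) B(2) show ?thesis unfolding maximal_def by metis
  qed
  with sub(2) liB have "maximal B (\<lambda>T. T \<subseteq> carrier_vec n \<and> lin_indpt T)"
    unfolding maximal_def by metis
  then have "basis B" by (rule max_li_is_basis)
  then have card: "card B = n" using dim_basis[OF B(1)] dim_is_n by simp
  obtain us where us: "set us = B - set (cols J)" "distinct us"
    using finite_distinct_list[of "B - set (cols J)"] B(1) by blast
  let ?bs = "cols J @ us"
  have bs: "distinct ?bs" "set ?bs = B" using us dist sub by auto
  have len: "length ?bs = n" using bs card distinct_card by metis
  define P where "P = mat_of_cols n ?bs"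
  have P: "P \<in> carrier_mat n n" using len by (metis P_def mat_of_cols_carrier(1))
  have cols: "cols P = ?bs" unfolding P_def by (rule cols_mat_of_cols) (use bs sub in auto)
  have "det P \<noteq> 0"
    using lin_indpt_full_rank[OF P] det_rank_iff[OF P] cols bs liB by simp
  from det_non_zero_imp_unit[OF P this] obtain P'
    where "P' \<in> carrier_mat n n" "P * P' = 1\<^sub>m n" "P' * P = 1\<^sub>m n"
    unfolding Units_def by (auto simp: ring_mat_simps)
  moreover have "col P j = col J j" if "j < p" for j
  proof -
    have "j < length (cols J)" "j < dim_col P" using that J P len by auto
    then show ?thesis using cols by (metis cols_length cols_nth nth_append)
  qed
  moreover have "p \<le> n" using len J by simp
  ultimately show ?thesis using P that by blast
qed

text \<open>
  The left inverse consists of the first \<open>p\<close> rows of the inverse of an invertible extension.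
\<close>

lemma inj_mat_left_inverse:
  fixes J :: "'k :: field mat"
  assumes J: "J \<in> carrier_mat n p" and inj: "inj_on (\<lambda>v. J *\<^sub>v v) (carrier_vec p)"
  obtains T where "T \<in> carrier_mat p n" "T * J = 1\<^sub>m p"
proof -
  from inj_mat_extends_to_invertible[OF J inj] obtain P P' where
    le: "p \<le> n" and P: "P \<in> carrier_mat n n" "P' \<in> carrier_mat n n" "P' * P = 1\<^sub>m n"
    and col: "\<And>j. j < p \<Longrightarrow> col P j = col J j" by metis
  define T where "T = mat p n (\<lambda>(i, j). P' $$ (i, j))"
  have T: "T \<in> carrier_mat p n" by (simp add: T_def)
  have "T * J = 1\<^sub>m p"
  proof (rule eq_matI)
    fix i j assume "i < dim_row (1\<^sub>m p :: 'k mat)" "j < dim_col (1\<^sub>m p :: 'k mat)"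
    then have ij: "i < p" "j < p" by auto
    then have row: "row T i = row P' i" using P le by (intro eq_vecI) (auto simp: T_def)
    have "(T * J) $$ (i, j) = row P' i \<bullet> col P j" using ij T J row col by simp
    also have "\<dots> = (P' * P) $$ (i, j)" using ij le P(1,2) by simp
    finally show "(T * J) $$ (i, j) = 1\<^sub>m p $$ (i, j)" using ij le P by simp
  qed (use T J in auto)
  with T show ?thesis by (rule that)
qed

text \<open>
  Coordinates on both spaces turn \<open>f\<close> into multiplication by a matrix, and the one-sided inverse of
  that matrix is transported back. The same reduction yields retractions of injective maps.
\<close>

lemma linear_surj_section:
  fixes V :: "('k :: field, 'v) module" and W :: "('k, 'w) module"
  assumes fdV: "vectorspace.fin_dim class_ring V" and fdW: "vectorspace.fin_dim class_ring W"
    and f: "linear_map class_ring V W f" and surj: "f ` carrier V = carrier W"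
  obtains s where "linear_map class_ring W V s" "\<And>y. y \<in> carrier W \<Longrightarrow> f (s y) = y"
proof -
  have V: "vectorspace class_ring V" and W: "vectorspace class_ring W"
    using f by (auto simp: linear_map_altdef)
  obtain n c where c: "linear_map class_ring V (module_vec TYPE('k) n) c"
      "bij_betw c (carrier V) (carrier_vec n)"
    using coordinates[OF V fdV] .
  obtain m d where d: "linear_map class_ring W (module_vec TYPE('k) m) d"
      "bij_betw d (carrier W) (carrier_vec m)"
    using coordinates[OF W fdW] .
  let ?c' = "the_inv_into (carrier V) c"
  have c': "linear_map class_ring (module_vec TYPE('k) n) V ?c'"
      "bij_betw ?c' (carrier_vec n) (carrier V)"
    using linear_map_the_inv_into[OF c(1)] bij_betw_the_inv_into[OF c(2)] c(2) by auto
  obtain R where R: "R \<in> carrier_mat m n"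
      "\<And>v. v \<in> carrier_vec n \<Longrightarrow> d (f (?c' v)) = R *\<^sub>v v"
    using linear_map_module_vec_eq_mult_mat_vec
      [OF linear_map_comp[OF linear_map_comp[OF c'(1) f] d(1)]] by (metis comp_apply)
  have "(\<lambda>v. R *\<^sub>v v) ` carrier_vec n = d ` f ` ?c' ` carrier_vec n"
    using R(2) by (auto simp: image_image)
  also have "\<dots> = carrier_vec m"
    using c'(2) d(2) surj by (simp add: bij_betw_def)
  finally obtain S where S: "S \<in> carrier_mat n m" "R * S = 1\<^sub>m m"
    by (rule surj_mat_right_inverse[OF R(1)])
  have lin: "linear_map class_ring W V (?c' \<circ> ((*\<^sub>v) S \<circ> d))"
    using linear_map_comp[OF linear_map_comp[OF d(1) linear_map_mult_mat_vec[OF S(1)]] c'(1)] .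
  have right_inv: "f (?c' (S *\<^sub>v d y)) = y" if y: "y \<in> carrier W" for y
  proof -
    have dy: "d y \<in> carrier_vec m" using linear_mapD(1)[OF d(1) y] by simp
    then have Sdy: "S *\<^sub>v d y \<in> carrier_vec n" using S(1) by simp
    have "d (f (?c' (S *\<^sub>v d y))) = (R * S) *\<^sub>v d y"
      using R S(1) dy Sdy by simp
    also have "\<dots> = d y" using S(2) dy by simp
    finally have "d (f (?c' (S *\<^sub>v d y))) = d y" .
    moreover have "f (?c' (S *\<^sub>v d y)) \<in> carrier W"
      using linear_mapD(1)[OF f] linear_mapD(1)[OF c'(1)] Sdy by simp
    ultimately show ?thesis using d(2) y by (metis bij_betw_imp_inj_on inj_onD)
  qed
  show ?thesis by (rule that[OF lin]) (simp only: comp_apply right_inv)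
qed

lemma linear_inj_retraction:
  fixes V :: "('k :: field, 'v) module" and W :: "('k, 'w) module"
  assumes fdV: "vectorspace.fin_dim class_ring V" and fdW: "vectorspace.fin_dim class_ring W"
    and f: "linear_map class_ring V W f" and inj: "inj_on f (carrier V)"
  obtains r where "linear_map class_ring W V r" "\<And>x. x \<in> carrier V \<Longrightarrow> r (f x) = x"
proof -
  have V: "vectorspace class_ring V" and W: "vectorspace class_ring W"
    using f by (auto simp: linear_map_altdef)
  obtain n c where c: "linear_map class_ring V (module_vec TYPE('k) n) c"
      "bij_betw c (carrier V) (carrier_vec n)"
    using coordinates[OF V fdV] .
  obtain m d where d: "linear_map class_ring W (module_vec TYPE('k) m) d"
      "bij_betw d (carrier W) (carrier_vec m)"
    using coordinates[OF W fdW] .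
  let ?c' = "the_inv_into (carrier V) c"
  have c': "linear_map class_ring (module_vec TYPE('k) n) V ?c'"
      "bij_betw ?c' (carrier_vec n) (carrier V)"
    using linear_map_the_inv_into[OF c(1)] bij_betw_the_inv_into[OF c(2)] c(2) by auto
  have c'c: "?c' (c x) = x" if "x \<in> carrier V" for x
    using that c(2) by (simp add: bij_betw_def the_inv_into_f_f)
  obtain J where J: "J \<in> carrier_mat m n"
      "\<And>v. v \<in> carrier_vec n \<Longrightarrow> d (f (?c' v)) = J *\<^sub>v v"
    using linear_map_module_vec_eq_mult_mat_vec
      [OF linear_map_comp[OF linear_map_comp[OF c'(1) f] d(1)]] by (metis comp_apply)
  have "inj_on (d \<circ> (f \<circ> ?c')) (carrier_vec n)"
  proof (intro comp_inj_on)
    show "inj_on f (?c' ` carrier_vec n)" using inj c'(2) by (simp add: bij_betw_def)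
    have "(f \<circ> ?c') ` carrier_vec n \<subseteq> carrier W"
      using linear_mapD(1)[OF f] linear_mapD(1)[OF c'(1)] by auto
    with d(2) show "inj_on d ((f \<circ> ?c') ` carrier_vec n)" by (metis bij_betw_def inj_on_subset)
  qed (use c'(2) in \<open>simp add: bij_betw_def\<close>)
  then have "inj_on (\<lambda>v. J *\<^sub>v v) (carrier_vec n)"
    using J(2) by (simp cong: inj_on_cong)
  then obtain T where T: "T \<in> carrier_mat n m" "T * J = 1\<^sub>m n"
    by (rule inj_mat_left_inverse[OF J(1)])
  have lin: "linear_map class_ring W V (?c' \<circ> ((*\<^sub>v) T \<circ> d))"
    using linear_map_comp[OF linear_map_comp[OF d(1) linear_map_mult_mat_vec[OF T(1)]] c'(1)] .
  have retract: "?c' (T *\<^sub>v d (f x)) = x" if x: "x \<in> carrier V" for x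
  proof -
    have cx: "c x \<in> carrier_vec n" using linear_mapD(1)[OF c(1) x] by simp
    have "d (f x) = J *\<^sub>v c x" using J(2)[OF cx] c'c[OF x] by simp
    then have "T *\<^sub>v d (f x) = (T * J) *\<^sub>v c x" using T(1) J(1) cx by simp
    then show ?thesis using T(2) cx c'c[OF x] by simp
  qed
  show ?thesis by (rule that[OF lin]) (simp only: comp_apply retract)
qed

lemma linear_map_restrict_domain:
  assumes "linear_map K V W f" "vectorspace K (V\<lparr>carrier := U\<rparr>)" "U \<subseteq> carrier V"
  shows "linear_map K (V\<lparr>carrier := U\<rparr>) W f"
  by (rule linear_mapI)
     (use assms linear_mapD[OF assms(1)] in \<open>auto simp: linear_map_altdef subset_iff\<close>)

text \<open>
  The image of a basis is linearly independent and has as many elements as the dimension.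
  Linear independence is first obtained inside the image of \<open>f\<close>, onto which \<open>f\<close> is a linear
  bijection, and then read in \<open>V\<close>.
\<close>

lemma linear_inj_endo_surj:
  fixes V :: "('k :: field, 'v) module"
  assumes fd: "vectorspace.fin_dim class_ring V"
    and f: "linear_map class_ring V V f" and inj: "inj_on f (carrier V)"
  shows "f ` carrier V = carrier V"
proof -
  interpret f: linear_map class_ring V V f by (rule f)
  let ?I = "V\<lparr>carrier := f ` carrier V\<rparr>"
  have sub: "submodule class_ring (f ` carrier V) V"
    using f.im_is_submodule by (simp add: f.im_def)
  have I: "vectorspace class_ring ?I"
    using f.V.subspace_is_vs[OF f.imT_is_subspace] by (simp add: f.im_def)
  interpret I: vectorspace class_ring ?I by (rule I)
  have fI: "linear_map class_ring V ?I f"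
    using f I unfolding linear_map_altdef LinearCombinations.module_hom_def by auto
  obtain B where B: "finite B" "f.V.basis B" using f.V.finite_basis_exists[OF fd] by blast
  then have BV: "B \<subseteq> carrier V" by (simp add: f.V.basis_def)
  then have fB: "f ` B \<subseteq> f ` carrier V" "f ` B \<subseteq> carrier V" by auto
  have basI: "I.basis (f ` B)"
    by (rule linear_map.linear_inj_image_is_basis[OF fI inj _ B(2) fd]) simp
  then have li: "f.V.module.lin_indpt (f ` B)"
    unfolding I.basis_def using f.V.module.span_li_not_depend(2)[OF fB(1) sub] by simp
  have "card (f ` B) = f.V.dim"
    using f.V.dim_basis[OF B] card_image inj_on_subset[OF inj BV] by metis
  with li have "f.V.basis (f ` B)"
    using f.V.dim_li_is_basis[OF fd _ fB(2)] B(1) by simp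
  then have "carrier V = f.V.module.span (f ` B)" unfolding f.V.basis_def by blast
  also have "\<dots> \<subseteq> f ` carrier V" by (rule f.V.module.span_is_subset[OF fB(1) sub])
  finally show ?thesis by auto
qed

section \<open>Compressions\<close>

text \<open>
  In contrast to homomorphisms the two maps go in opposite directions, \<open>i\<close> from \<open>N\<close> into \<open>M\<close> and
  \<open>r\<close> from \<open>M\<close> onto \<open>N\<close>. For matrices this means that \<open>E' = R * E * J\<close> and \<open>H' = R * H * J\<close>
  with \<open>J\<close> injective and \<open>R\<close> surjective.
\<close>

definition compression ::
  "('k :: field, 'v, 'w) kronecker \<Rightarrow> ('k, 'x, 'y) kronecker \<Rightarrow> bool" where
  "compression M N \<longleftrightarrow> (\<exists>i r.
     linear_map class_ring (space1 N) (space1 M) i \<and> inj_on i (carrier (space1 N)) \<and>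
     linear_map class_ring (space2 M) (space2 N) r \<and>
     r ` carrier (space2 M) = carrier (space2 N) \<and>
     (\<forall>x \<in> carrier (space1 N). r (map_alpha M (i x)) = map_alpha N x) \<and>
     (\<forall>x \<in> carrier (space1 N). r (map_beta M (i x)) = map_beta N x))"

lemma compressionE:
  assumes "compression M N"
  obtains i r where "linear_map class_ring (space1 N) (space1 M) i" "inj_on i (carrier (space1 N))"
    "linear_map class_ring (space2 M) (space2 N) r" "r ` carrier (space2 M) = carrier (space2 N)"
    "\<And>x. x \<in> carrier (space1 N) \<Longrightarrow> r (map_alpha M (i x)) = map_alpha N x"
    "\<And>x. x \<in> carrier (space1 N) \<Longrightarrow> r (map_beta M (i x)) = map_beta N x"
  using assms unfolding compression_def by blast

lemma compression_trans:
  assumes "compression L M" "compression M N"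
  shows "compression L N"
proof -
  from assms(1) obtain i r where 1: "linear_map class_ring (space1 M) (space1 L) i"
    "inj_on i (carrier (space1 M))"
    "linear_map class_ring (space2 L) (space2 M) r" "r ` carrier (space2 L) = carrier (space2 M)"
    "\<And>x. x \<in> carrier (space1 M) \<Longrightarrow> r (map_alpha L (i x)) = map_alpha M x"
    "\<And>x. x \<in> carrier (space1 M) \<Longrightarrow> r (map_beta L (i x)) = map_beta M x"
    by (rule compressionE) metis
  from assms(2) obtain j s where 2: "linear_map class_ring (space1 N) (space1 M) j"
    "inj_on j (carrier (space1 N))"
    "linear_map class_ring (space2 M) (space2 N) s" "s ` carrier (space2 M) = carrier (space2 N)"
    "\<And>x. x \<in> carrier (space1 N) \<Longrightarrow> s (map_alpha M (j x)) = map_alpha N x"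
    "\<And>x. x \<in> carrier (space1 N) \<Longrightarrow> s (map_beta M (j x)) = map_beta N x"
    by (rule compressionE) metis
  have j: "j x \<in> carrier (space1 M)" if "x \<in> carrier (space1 N)" for x
    using linear_mapD(1)[OF 2(1)] that .
  have "inj_on (i \<circ> j) (carrier (space1 N))"
    by (rule comp_inj_on[OF 2(2)]) (use 1(2) j in \<open>auto intro: inj_on_subset\<close>)
  moreover have "(s \<circ> r) ` carrier (space2 L) = carrier (space2 N)"
    using 1(4) 2(4) by (metis image_comp)
  ultimately show ?thesis
    unfolding compression_def using linear_map_comp[OF 2(1) 1(1)] linear_map_comp[OF 1(3) 2(3)]
      1(5,6)[OF j] 2(5,6) by (intro exI[of _ "i \<circ> j"] exI[of _ "s \<circ> r"]) simp
qed

lemma isomorphic_imp_compression: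
  assumes "isomorphic M N"
  shows "compression M N"
proof -
  obtain f g where f: "linear_map class_ring (space1 M) (space1 N) f"
    "bij_betw f (carrier (space1 M)) (carrier (space1 N))"
    and g: "linear_map class_ring (space2 M) (space2 N) g"
    "bij_betw g (carrier (space2 M)) (carrier (space2 N))"
    and comm: "\<And>x. x \<in> carrier (space1 M) \<Longrightarrow> map_alpha N (f x) = g (map_alpha M x)"
      "\<And>x. x \<in> carrier (space1 M) \<Longrightarrow> map_beta N (f x) = g (map_beta M x)"
    using assms unfolding isomorphic_def kronecker_iso_def kronecker_hom_def by metis
  let ?f = "the_inv_into (carrier (space1 M)) f"
  have "?f y \<in> carrier (space1 M)" "f (?f y) = y" if "y \<in> carrier (space1 N)" for y
    using that f(2) by (auto simp: bij_betw_def the_inv_into_into f_the_inv_into_f)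
  then have "g (map_alpha M (?f y)) = map_alpha N y" "g (map_beta M (?f y)) = map_beta N y"
    if "y \<in> carrier (space1 N)" for y
    using comm that by metis+
  then show ?thesis
    unfolding compression_def
    using linear_map_the_inv_into[OF f] bij_betw_the_inv_into[OF f(2)] g
    by (intro exI[of _ ?f] exI[of _ g]) (simp add: bij_betw_def)
qed

text \<open>
  The first component of a monomorphism already has the right direction; the second one is
  replaced by a linear retraction. Dually, an epimorphism gives a compression by a linear
  section of its first component.
\<close>

lemma subrepresentation_imp_compression:
  assumes M: "kronecker_rep M" and N: "kronecker_rep N" and "subrepresentation N M"
  shows "compression M N"
proof -
  obtain f g where f: "linear_map class_ring (space1 N) (space1 M) f" "inj_on f (carrier (space1 N))"
    and g: "linear_map class_ring (space2 N) (space2 M) g" "inj_on g (carrier (space2 N))"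
    and comm: "\<And>x. x \<in> carrier (space1 N) \<Longrightarrow> map_alpha M (f x) = g (map_alpha N x)"
      "\<And>x. x \<in> carrier (space1 N) \<Longrightarrow> map_beta M (f x) = g (map_beta N x)"
    using assms(3) unfolding subrepresentation_def kronecker_mono_def kronecker_hom_def by metis
  have lin: "linear_map class_ring (space1 N) (space2 N) (map_alpha N)"
    "linear_map class_ring (space1 N) (space2 N) (map_beta N)"
    and fd: "vectorspace.fin_dim class_ring (space2 N)" "vectorspace.fin_dim class_ring (space2 M)"
    using M N by (auto simp: kronecker_rep_def)
  obtain r where r: "linear_map class_ring (space2 M) (space2 N) r"
    "\<And>y. y \<in> carrier (space2 N) \<Longrightarrow> r (g y) = y"
    using linear_inj_retraction[OF fd g] by blast
  have "r ` carrier (space2 M) = carrier (space2 N)"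
    using linear_mapD(1)[OF r(1)] linear_mapD(1)[OF g(1)] r(2) by (metis image_eqI image_subsetI subsetI subset_antisym)
  then show ?thesis
    unfolding compression_def using f r comm linear_mapD(1)[OF lin(1)] linear_mapD(1)[OF lin(2)]
    by (intro exI[of _ f] exI[of _ r]) simp
qed

lemma factor_representation_imp_compression:
  assumes M: "kronecker_rep M" and N: "kronecker_rep N" and "factor_representation N M"
  shows "compression M N"
proof -
  obtain f g where f: "linear_map class_ring (space1 M) (space1 N) f"
      "f ` carrier (space1 M) = carrier (space1 N)"
    and g: "linear_map class_ring (space2 M) (space2 N) g"
      "g ` carrier (space2 M) = carrier (space2 N)"
    and comm: "\<And>x. x \<in> carrier (space1 M) \<Longrightarrow> map_alpha N (f x) = g (map_alpha M x)"
      "\<And>x. x \<in> carrier (space1 M) \<Longrightarrow> map_beta N (f x) = g (map_beta M x)"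
    using assms(3) unfolding factor_representation_def kronecker_epi_def kronecker_hom_def by metis
  have fd: "vectorspace.fin_dim class_ring (space1 M)" "vectorspace.fin_dim class_ring (space1 N)"
    using M N by (auto simp: kronecker_rep_def)
  obtain s where s: "linear_map class_ring (space1 N) (space1 M) s"
    "\<And>x. x \<in> carrier (space1 N) \<Longrightarrow> f (s x) = x"
    using linear_surj_section[OF fd f] by blast
  have "inj_on s (carrier (space1 N))" using s(2) by (metis inj_onI)
  then show ?thesis
    unfolding compression_def using s g comm linear_mapD(1)[OF s(1)]
    by (intro exI[of _ s] exI[of _ g]) metis
qed

text \<open>
  Replacing \<open>space1 M\<close> by the image of \<open>i\<close> and keeping all of \<open>space2 M\<close> gives a
  subrepresentation of \<open>M\<close>. The inverse of \<open>i\<close> together with \<open>r\<close> maps it onto \<open>N\<close>.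
\<close>

lemma compression_imp_subfactor:
  fixes M :: "('k :: field, 'v, 'w) kronecker" and N :: "('k, 'x, 'y) kronecker"
  assumes M: "kronecker_rep M" and N: "kronecker_rep N" and c: "compression M N"
  shows "subfactor N M"
proof -
  from c obtain i r where i: "linear_map class_ring (space1 N) (space1 M) i"
      "inj_on i (carrier (space1 N))"
    and r: "linear_map class_ring (space2 M) (space2 N) r"
      "r ` carrier (space2 M) = carrier (space2 N)"
    and eq: "\<And>x. x \<in> carrier (space1 N) \<Longrightarrow> r (map_alpha M (i x)) = map_alpha N x"
    "\<And>x. x \<in> carrier (space1 N) \<Longrightarrow> r (map_beta M (i x)) = map_beta N x"
    by (rule compressionE) metis
  let ?I = "space1 M\<lparr>carrier := i ` carrier (space1 N)\<rparr>"
  let ?L = "M\<lparr>space1 := ?I\<rparr>"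
  interpret i: linear_map class_ring "space1 N" "space1 M" i by (rule i(1))
  have sub: "x \<in> carrier (space1 M)" if "x \<in> i ` carrier (space1 N)" for x
    using that i.f_im by auto
  have I: "vectorspace class_ring ?I"
    using i.W.subspace_is_vs[OF i.imT_is_subspace] by (simp add: i.im_def)
  have iI: "linear_map class_ring (space1 N) ?I i"
    using i(1) I unfolding linear_map_altdef LinearCombinations.module_hom_def by auto
  have bij: "bij_betw i (carrier (space1 N)) (carrier ?I)"
    using i(2) by (simp add: bij_betw_def)
  have fdI: "vectorspace.fin_dim class_ring ?I"
    using linear_map.surj_fin_dim[OF iI] N by (simp add: kronecker_rep_def)
  have incl: "linear_map class_ring ?I (space1 M) id"
    using M sub by (intro linear_map_restrict_domain[OF _ I] linear_map_id) (auto simp: kronecker_rep_def)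
  have L: "kronecker_rep ?L"
    using M I fdI linear_map_restrict_domain[OF _ I] sub by (auto simp: kronecker_rep_def)
  have "kronecker_mono ?L M id id"
    using M incl by (simp add: kronecker_mono_def kronecker_hom_def linear_map_id kronecker_rep_def)
  then have "subrepresentation ?L M" unfolding subrepresentation_def by blast
  moreover have "kronecker_epi ?L N (the_inv_into (carrier (space1 N)) i) r"
    unfolding kronecker_epi_def kronecker_hom_def
    using linear_map_the_inv_into[OF iI bij] bij_betw_the_inv_into[OF bij] r eq i(2)
    by (auto simp: the_inv_into_f_f bij_betw_def)
  then have "factor_representation N ?L" unfolding factor_representation_def by blast
  ultimately show ?thesis unfolding subfactor_def using L by blast
qed

lemma subfactor_iff_compression:
  fixes M :: "('k :: field, 'v, 'w) kronecker" and N :: "('k, 'x, 'y) kronecker"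
  assumes M: "kronecker_rep M" and N: "kronecker_rep N"
  shows "subfactor N M \<longleftrightarrow> compression M N"
proof
  assume "subfactor N M"
  then obtain L :: "('k, 'v, 'w) kronecker"
    where L: "kronecker_rep L" "subrepresentation L M" "factor_representation N L"
    unfolding subfactor_def by blast
  show "compression M N"
    using subrepresentation_imp_compression[OF M L(1,2)]
      factor_representation_imp_compression[OF L(1) N L(3)] by (rule compression_trans)
qed (rule compression_imp_subfactor[OF M N])

text \<open>
  Going back and forth gives an injective endomorphism of \<open>space1 M\<close> and a surjective one of
  \<open>space2 M\<close>. By finite dimension both are bijective, which makes \<open>i\<close> and \<open>r\<close> bijective; the
  isomorphism is the inverse of \<open>i\<close> paired with \<open>r\<close>.
\<close>

lemma compression_antisym:
  fixes M :: "('k :: field, 'v, 'w) kronecker" and N :: "('k, 'x, 'y) kronecker"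
  assumes M: "kronecker_rep M" and "compression M N" "compression N M"
  shows "isomorphic M N"
proof -
  obtain i r where i: "linear_map class_ring (space1 N) (space1 M) i" "inj_on i (carrier (space1 N))"
    and r: "linear_map class_ring (space2 M) (space2 N) r" "r ` carrier (space2 M) = carrier (space2 N)"
    and comm: "\<And>x. x \<in> carrier (space1 N) \<Longrightarrow> r (map_alpha M (i x)) = map_alpha N x"
      "\<And>x. x \<in> carrier (space1 N) \<Longrightarrow> r (map_beta M (i x)) = map_beta N x"
    using assms(2) by (rule compressionE) metis
  obtain j s where j: "linear_map class_ring (space1 M) (space1 N) j" "inj_on j (carrier (space1 M))"
    and s: "linear_map class_ring (space2 N) (space2 M) s" "s ` carrier (space2 N) = carrier (space2 M)"
    using assms(3) by (rule compressionE) metis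
  have fd: "vectorspace.fin_dim class_ring (space1 M)" "vectorspace.fin_dim class_ring (space2 M)"
    using M by (auto simp: kronecker_rep_def)
  have j_im: "j ` carrier (space1 M) \<subseteq> carrier (space1 N)"
    using linear_mapD(1)[OF j(1)] by auto
  have "inj_on (i \<circ> j) (carrier (space1 M))"
    using j(2) inj_on_subset[OF i(2) j_im] by (rule comp_inj_on)
  then have "i ` j ` carrier (space1 M) = carrier (space1 M)"
    using linear_inj_endo_surj[OF fd(1) linear_map_comp[OF j(1) i(1)]] by (simp add: image_comp)
  then have "i ` carrier (space1 N) = carrier (space1 M)"
    using j_im linear_mapD(1)[OF i(1)] by blast
  then have bi: "bij_betw i (carrier (space1 N)) (carrier (space1 M))"
    using i(2) by (simp add: bij_betw_def)
  have sr: "linear_map class_ring (space2 M) (space2 M) (s \<circ> r)"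
    by (rule linear_map_comp[OF r(1) s(1)])
  have sr_surj: "(s \<circ> r) ` carrier (space2 M) = carrier (space2 M)"
    using r(2) s(2) by (metis image_comp)
  \<comment> \<open>A section of the surjective endomorphism is injective, hence surjective, hence a two-sided inverse.\<close>
  obtain t where t: "linear_map class_ring (space2 M) (space2 M) t"
    "\<And>y. y \<in> carrier (space2 M) \<Longrightarrow> (s \<circ> r) (t y) = y"
    using linear_surj_section[OF fd(2) fd(2) sr sr_surj] by blast
  have "inj_on t (carrier (space2 M))" using t(2) by (metis inj_onI)
  then have t_surj: "t ` carrier (space2 M) = carrier (space2 M)"
    by (rule linear_inj_endo_surj[OF fd(2) t(1)])
  have "t (s (r x)) = x" if "x \<in> carrier (space2 M)" for x
  proof -
    from that have "x \<in> t ` carrier (space2 M)" by (simp only: t_surj)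
    then obtain y where y: "x = t y" "y \<in> carrier (space2 M)" by (rule imageE)
    show ?thesis using t(2)[OF y(2)] unfolding y(1) comp_apply by (rule arg_cong)
  qed
  then have "inj_on r (carrier (space2 M))" by (metis inj_onI)
  then have br: "bij_betw r (carrier (space2 M)) (carrier (space2 N))"
    using r(2) by (simp add: bij_betw_def)
  let ?f = "the_inv_into (carrier (space1 N)) i"
  have inv: "?f x \<in> carrier (space1 N)" "i (?f x) = x" if "x \<in> carrier (space1 M)" for x
    using that bi by (auto simp: bij_betw_def the_inv_into_into f_the_inv_into_f)
  have "kronecker_iso M N ?f r"
    unfolding kronecker_iso_def kronecker_hom_def
    using linear_map_the_inv_into[OF i(1) bi] bij_betw_the_inv_into[OF bi] r(1) br
      comm[OF inv(1)] inv(2) by simp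
  then show ?thesis unfolding isomorphic_def by blast
qed

section \<open>Compressions of matrix pairs are upper left blocks\<close>

lemma matrix_rep_simps [simp]:
  "space1 (matrix_rep (E :: 'k :: field mat) H) = module_vec TYPE('k) (dim_col E)"
  "space2 (matrix_rep E H) = module_vec TYPE('k) (dim_row E)"
  "map_alpha (matrix_rep E H) v = E *\<^sub>v v"
  "map_beta (matrix_rep E H) v = H *\<^sub>v v"
  by (simp_all add: matrix_rep_def)

text \<open>
  The matrices of the two maps are taken with respect to one choice of coordinates on each of
  the two spaces.
\<close>

lemma isomorphic_matrix_rep:
  fixes M :: "('k :: field, 'v, 'w) kronecker"
  assumes M: "kronecker_rep M"
  obtains a b E H where "E \<in> carrier_mat a b" "H \<in> carrier_mat a b" "isomorphic M (matrix_rep E H)"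
proof -
  from M have V: "vectorspace class_ring (space1 M)" "vectorspace.fin_dim class_ring (space1 M)"
    and W: "vectorspace class_ring (space2 M)" "vectorspace.fin_dim class_ring (space2 M)"
    and lin: "linear_map class_ring (space1 M) (space2 M) (map_alpha M)"
      "linear_map class_ring (space1 M) (space2 M) (map_beta M)"
    by (auto simp: kronecker_rep_def)
  obtain b c where c: "linear_map class_ring (space1 M) (module_vec TYPE('k) b) c"
      "bij_betw c (carrier (space1 M)) (carrier_vec b)"
    using coordinates[OF V] .
  obtain a d where d: "linear_map class_ring (space2 M) (module_vec TYPE('k) a) d"
      "bij_betw d (carrier (space2 M)) (carrier_vec a)"
    using coordinates[OF W] .
  have matrix: "\<exists>A \<in> carrier_mat a b. \<forall>x \<in> carrier (space1 M). A *\<^sub>v c x = d (f x)"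
    if f: "linear_map class_ring (space1 M) (space2 M) f" for f
  proof -
    let ?c' = "the_inv_into (carrier (space1 M)) c"
    have c': "linear_map class_ring (module_vec TYPE('k) b) (space1 M) ?c'"
      using linear_map_the_inv_into[OF c(1)] c(2) by simp
    obtain A where A: "A \<in> carrier_mat a b"
        "\<And>v. v \<in> carrier_vec b \<Longrightarrow> d (f (?c' v)) = A *\<^sub>v v"
      using linear_map_module_vec_eq_mult_mat_vec
        [OF linear_map_comp[OF linear_map_comp[OF c' f] d(1)]] by (metis comp_apply)
    have "A *\<^sub>v c x = d (f x)" if "x \<in> carrier (space1 M)" for x
      using A(2)[of "c x"] linear_mapD(1)[OF c(1) that] that c(2)
      by (simp add: bij_betw_def the_inv_into_f_f)
    with A(1) show ?thesis by blast
  qed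
  obtain E where E: "E \<in> carrier_mat a b" "\<And>x. x \<in> carrier (space1 M) \<Longrightarrow> E *\<^sub>v c x = d (map_alpha M x)"
    using matrix[OF lin(1)] by blast
  obtain H where H: "H \<in> carrier_mat a b" "\<And>x. x \<in> carrier (space1 M) \<Longrightarrow> H *\<^sub>v c x = d (map_beta M x)"
    using matrix[OF lin(2)] by blast
  have "kronecker_iso M (matrix_rep E H) c d"
    unfolding kronecker_iso_def kronecker_hom_def using c d E H by simp
  then have "isomorphic M (matrix_rep E H)" unfolding isomorphic_def by blast
  with E(1) H(1) show ?thesis by (rule that)
qed

text \<open>
  The first \<open>p\<close> coordinates are included into all of them, and the last \<open>n\<close> coordinates are
  forgotten: these two maps cut out the upper left block.
\<close>

lemma four_block_compression:
  fixes A :: "'k :: field mat"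
  assumes A: "A \<in> carrier_mat m p" and B: "B \<in> carrier_mat m q"
    and C: "C \<in> carrier_mat n p" and D: "D \<in> carrier_mat n q"
    and A': "A' \<in> carrier_mat m p" and B': "B' \<in> carrier_mat m q"
    and C': "C' \<in> carrier_mat n p" and D': "D' \<in> carrier_mat n q"
  shows "compression (matrix_rep (four_block_mat A B C D) (four_block_mat A' B' C' D'))
    (matrix_rep A A')"
proof -
  let ?i = "\<lambda>v :: 'k vec. v @\<^sub>v 0\<^sub>v q" and ?r = "\<lambda>w :: 'k vec. vec_first w m"
  have first: "vec_first (u @\<^sub>v w) m = u" if "u \<in> carrier_vec m" for u w :: "'k vec"
    using that by (intro eq_vecI) (auto simp: vec_first_def)
  have i: "linear_map class_ring (module_vec TYPE('k) p) (module_vec TYPE('k) (p + q)) ?i"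
    by (rule linear_mapI) (auto simp: vec_vs module_vec_simps intro!: eq_vecI)
  have inj: "inj_on ?i (carrier_vec p)"
    by (rule inj_onI) (auto simp: append_vec_eq)
  have r: "linear_map class_ring (module_vec TYPE('k) (m + n)) (module_vec TYPE('k) m) ?r"
    by (rule linear_mapI) (auto simp: vec_vs module_vec_simps vec_first_def intro!: eq_vecI)
  have surj: "?r ` carrier_vec (m + n) = carrier_vec m"
  proof
    show "carrier_vec m \<subseteq> ?r ` carrier_vec (m + n)"
    proof
      fix u :: "'k vec" assume u: "u \<in> carrier_vec m"
      show "u \<in> ?r ` carrier_vec (m + n)"
        by (rule image_eqI[of _ _ "u @\<^sub>v 0\<^sub>v n"]) (use u first[OF u] in auto)
    qed
  qed auto
  have mult: "?r (four_block_mat X Y Z U *\<^sub>v ?i v) = X *\<^sub>v v"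
    if "X \<in> carrier_mat m p" "Y \<in> carrier_mat m q" "Z \<in> carrier_mat n p" "U \<in> carrier_mat n q"
      "v \<in> carrier_vec p" for X Y Z U v
  proof -
    have "four_block_mat X Y Z U *\<^sub>v ?i v = (X *\<^sub>v v + Y *\<^sub>v 0\<^sub>v q) @\<^sub>v (Z *\<^sub>v v + U *\<^sub>v 0\<^sub>v q)"
      by (rule four_block_mat_mult_vec[OF that]) simp
    moreover have "X *\<^sub>v v + Y *\<^sub>v 0\<^sub>v q = X *\<^sub>v v" using that by (intro eq_vecI) auto
    moreover have "X *\<^sub>v v \<in> carrier_vec m" using that by simp
    ultimately show ?thesis by (simp add: first)
  qed
  show ?thesis
    unfolding compression_def
    using assms i inj r surj mult[OF A B C D] mult[OF A' B' C' D']
    by (intro exI[of _ ?i] exI[of _ ?r]) simp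
qed

text \<open>
  Write the compression as \<open>E' = R * E * J\<close>, \<open>H' = R * H * J\<close>, and complete \<open>J\<close> by columns to
  an invertible \<open>P\<close> and \<open>R\<close> by rows to an invertible \<open>Q\<close>. Then \<open>Q * E * P\<close> and \<open>Q * H * P\<close> have
  the upper left blocks \<open>E'\<close> and \<open>H'\<close>, and multiplication by the inverse of \<open>P\<close> and by \<open>Q\<close> is an
  isomorphism from \<open>(E, H)\<close> to this pair.
\<close>

lemma compression_imp_matrix_succ:
  fixes E :: "'k :: field mat"
  assumes E: "E \<in> carrier_mat a b" and H: "H \<in> carrier_mat a b"
    and E': "E' \<in> carrier_mat m p" and H': "H' \<in> carrier_mat m p"
    and c: "compression (matrix_rep E H) (matrix_rep E' H')"
  shows "matrix_succ E H E' H'"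
proof -
  from c obtain i r where
    i: "linear_map class_ring (module_vec TYPE('k) p) (module_vec TYPE('k) b) i"
      "inj_on i (carrier_vec p)"
    and r: "linear_map class_ring (module_vec TYPE('k) a) (module_vec TYPE('k) m) r"
      "r ` carrier_vec a = carrier_vec m"
    and eq: "\<And>x. x \<in> carrier_vec p \<Longrightarrow> r (E *\<^sub>v i x) = E' *\<^sub>v x"
      "\<And>x. x \<in> carrier_vec p \<Longrightarrow> r (H *\<^sub>v i x) = H' *\<^sub>v x"
    by (rule compressionE) (use E H E' H' in simp)
  obtain J where J: "J \<in> carrier_mat b p" "\<And>v. v \<in> carrier_vec p \<Longrightarrow> i v = J *\<^sub>v v"
    using linear_map_module_vec_eq_mult_mat_vec[OF i(1)] by blast
  obtain R where R: "R \<in> carrier_mat m a" "\<And>v. v \<in> carrier_vec a \<Longrightarrow> r v = R *\<^sub>v v"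
    using linear_map_module_vec_eq_mult_mat_vec[OF r(1)] by blast
  have inj: "inj_on (\<lambda>v. J *\<^sub>v v) (carrier_vec p)"
    using i(2) J(2) by (simp cong: inj_on_cong)
  obtain P P' where le_p: "p \<le> b" and P: "P \<in> carrier_mat b b" "P' \<in> carrier_mat b b"
      "P * P' = 1\<^sub>m b" "P' * P = 1\<^sub>m b" and colP: "\<And>j. j < p \<Longrightarrow> col P j = col J j"
    by (rule inj_mat_extends_to_invertible[OF J(1) inj]) blast
  have surj: "(\<lambda>v. R *\<^sub>v v) ` carrier_vec a = carrier_vec m"
    using r(2) R(2) by (simp cong: image_cong)
  obtain S where S: "S \<in> carrier_mat a m" "R * S = 1\<^sub>m m"
    by (rule surj_mat_right_inverse[OF R(1) surj])
  \<comment> \<open>Completing rows of the surjective \<open>R\<close> is completing columns of its injective transpose.\<close>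
  have "S\<^sup>T * R\<^sup>T = 1\<^sub>m m" using S R(1) by (metis transpose_mult transpose_one)
  then have "S\<^sup>T *\<^sub>v (R\<^sup>T *\<^sub>v v) = v" if "v \<in> carrier_vec m" for v
    using that S(1) R(1) by (metis assoc_mult_mat_vec one_mult_mat_vec transpose_carrier_mat)
  then have injT: "inj_on (\<lambda>v. R\<^sup>T *\<^sub>v v) (carrier_vec m)" by (metis inj_onI)
  have RT: "R\<^sup>T \<in> carrier_mat a m" using R(1) by simp
  obtain Q0 Q0' where le_m: "m \<le> a" and Q0: "Q0 \<in> carrier_mat a a" "Q0' \<in> carrier_mat a a"
      "Q0 * Q0' = 1\<^sub>m a" "Q0' * Q0 = 1\<^sub>m a" and colQ: "\<And>i. i < m \<Longrightarrow> col Q0 i = col R\<^sup>T i"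
    by (rule inj_mat_extends_to_invertible[OF RT injT]) blast
  define Q Q' where "Q = Q0\<^sup>T" and "Q' = Q0'\<^sup>T"
  have Q: "Q \<in> carrier_mat a a" "Q' \<in> carrier_mat a a" "Q * Q' = 1\<^sub>m a" "Q' * Q = 1\<^sub>m a"
    using Q0 unfolding Q_def Q'_def by (simp_all flip: transpose_mult)
  have rowQ: "row Q i = row R i" if "i < m" for i
    using that colQ[of i] le_m Q0(1) R(1) unfolding Q_def by simp
  have block: "\<exists>B C D. B \<in> carrier_mat m (b - p) \<and> C \<in> carrier_mat (a - m) p \<and>
      D \<in> carrier_mat (a - m) (b - p) \<and> Q * X * P = four_block_mat X' B C D"
    if X: "X \<in> carrier_mat a b" and X': "X' \<in> carrier_mat m p"
      and eq: "\<And>x. x \<in> carrier_vec p \<Longrightarrow> r (X *\<^sub>v i x) = X' *\<^sub>v x" for X X'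
  proof -
    have QXP: "Q * X * P \<in> carrier_mat a b" using Q P X by simp
    obtain A B C D where s: "split_block (Q * X * P) m p = (A, B, C, D)"
      by (cases "split_block (Q * X * P) m p")
    have dims: "dim_row (Q * X * P) = m + (a - m)" "dim_col (Q * X * P) = p + (b - p)"
      using QXP le_m le_p by auto
    note sb = split_block[OF s dims]
    have "A = X'"
    proof (rule eq_matI)
      fix k j assume "k < dim_row X'" "j < dim_col X'"
      then have k: "k < m" and j: "j < p" using X' by auto
      have ij: "i (unit_vec p j) = col P j"
        using J(2)[of "unit_vec p j"] colP[OF j] J(1) j by (auto intro!: eq_vecI)
      have cP: "col P j \<in> carrier_vec b" using P(1) j le_p by auto
      have "A $$ (k, j) = (Q * X * P) $$ (k, j)"
        using s k j unfolding split_block_def Let_def by auto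
      also have "\<dots> = (Q * (X * P)) $$ (k, j)" using Q P X by simp
      also have "\<dots> = row Q k \<bullet> col (X * P) j"
        by (rule index_mult_mat(1)) (use Q P X k j le_m le_p in auto)
      also have "col (X * P) j = X *\<^sub>v col P j"
        by (rule col_mult2[OF X P(1)]) (use j le_p in simp)
      also have "row Q k \<bullet> (X *\<^sub>v col P j) = (R *\<^sub>v (X *\<^sub>v col P j)) $ k" using rowQ[OF k] R(1) k by simp
      also have "R *\<^sub>v (X *\<^sub>v col P j) = X' *\<^sub>v unit_vec p j"
        using eq[of "unit_vec p j"] ij R(2)[of "X *\<^sub>v col P j"] X cP by simp
      also have "(X' *\<^sub>v unit_vec p j) $ k = X' $$ (k, j)" using X' k j by simp
      finally show "A $$ (k, j) = X' $$ (k, j)" .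
    qed (use sb(1) X' in auto)
    with sb show ?thesis by blast
  qed
  obtain E12 E21 E22 where E_blocks: "E12 \<in> carrier_mat m (b - p)" "E21 \<in> carrier_mat (a - m) p"
      "E22 \<in> carrier_mat (a - m) (b - p)" "Q * E * P = four_block_mat E' E12 E21 E22"
    using block[OF E E' eq(1)] by blast
  obtain H12 H21 H22 where H_blocks: "H12 \<in> carrier_mat m (b - p)" "H21 \<in> carrier_mat (a - m) p"
      "H22 \<in> carrier_mat (a - m) (b - p)" "Q * H * P = four_block_mat H' H12 H21 H22"
    using block[OF H H' eq(2)] by blast
  have bij: "bij_betw (\<lambda>v. X *\<^sub>v v) (carrier_vec n) (carrier_vec n)"
    if "X \<in> carrier_mat n n" "Y \<in> carrier_mat n n" "X * Y = 1\<^sub>m n" "Y * X = 1\<^sub>m n"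
    for X Y :: "'k mat" and n
    by (rule bij_betwI[where g = "\<lambda>v. Y *\<^sub>v v"])
       (use that in \<open>auto simp flip: assoc_mult_mat_vec\<close>)
  have "kronecker_iso (matrix_rep E H) (matrix_rep (Q * E * P) (Q * H * P))
      (\<lambda>v. P' *\<^sub>v v) (\<lambda>v. Q *\<^sub>v v)"
  proof -
    have "(Q * X * P) *\<^sub>v (P' *\<^sub>v v) = Q *\<^sub>v (X *\<^sub>v v)"
      if X: "X \<in> carrier_mat a b" and v: "v \<in> carrier_vec b" for X v
    proof -
      have "(Q * X * P) *\<^sub>v (P' *\<^sub>v v) = (Q * X) *\<^sub>v (P *\<^sub>v (P' *\<^sub>v v))"
        using Q(1) P(1,2) X v by (intro assoc_mult_mat_vec) auto
      also have "P *\<^sub>v (P' *\<^sub>v v) = v"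
        using P v by (metis assoc_mult_mat_vec one_mult_mat_vec)
      also have "(Q * X) *\<^sub>v v = Q *\<^sub>v (X *\<^sub>v v)"
        using Q(1) X v by (intro assoc_mult_mat_vec) auto
      finally show ?thesis .
    qed
    then show ?thesis
      unfolding kronecker_iso_def kronecker_hom_def
      using E H P Q linear_map_mult_mat_vec[OF P(2)] linear_map_mult_mat_vec[OF Q(1)]
        bij[OF P(2,1,4,3)] bij[OF Q] by simp
  qed
  then have iso: "isomorphic (matrix_rep E H)
      (matrix_rep (four_block_mat E' E12 E21 E22) (four_block_mat H' H12 H21 H22))"
    unfolding isomorphic_def E_blocks(4) H_blocks(4) by blast
  have "E \<in> carrier_mat (m + (a - m)) (p + (b - p))" "H \<in> carrier_mat (m + (a - m)) (p + (b - p))"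
    using E H le_m le_p by simp_all
  with iso E_blocks(1-3) H_blocks(1-3) E' H' show ?thesis
    unfolding matrix_succ_def by blast
qed

lemma matrix_succ_imp_compression:
  assumes "matrix_succ E H E' H'"
  shows "compression (matrix_rep E H) (matrix_rep E' H')"
proof -
  from assms obtain m n p q E12 H12 E21 H21 E22 H22 where
    blocks: "E' \<in> carrier_mat m p" "E12 \<in> carrier_mat m q" "E21 \<in> carrier_mat n p"
      "E22 \<in> carrier_mat n q" "H' \<in> carrier_mat m p" "H12 \<in> carrier_mat m q"
      "H21 \<in> carrier_mat n p" "H22 \<in> carrier_mat n q"
    and iso: "isomorphic (matrix_rep E H)
      (matrix_rep (four_block_mat E' E12 E21 E22) (four_block_mat H' H12 H21 H22))"
    unfolding matrix_succ_def by (elim exE conjE) metis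
  show ?thesis
    using isomorphic_imp_compression[OF iso] four_block_compression[OF blocks]
    by (rule compression_trans)
qed

text \<open>
  Compressions are defined without coordinates and are transitive, and isomorphisms are among
  them, so the choice of matrices in \<open>kronecker_succ\<close> does not matter.
\<close>

lemma kronecker_succ_iff_compression:
  assumes M: "kronecker_rep M" and N: "kronecker_rep N"
  shows "kronecker_succ M N \<longleftrightarrow> compression M N"
proof
  assume "kronecker_succ M N"
  then obtain E H E' H' where "isomorphic M (matrix_rep E H)" "isomorphic N (matrix_rep E' H')"
    "matrix_succ E H E' H'" unfolding kronecker_succ_def by blast
  then show "compression M N"
    using isomorphic_imp_compression matrix_succ_imp_compression compression_trans
      isomorphic_sym[OF N] by metis
next
  assume c: "compression M N"
  obtain a b E H where E: "E \<in> carrier_mat a b" "H \<in> carrier_mat a b"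
    and ME: "isomorphic M (matrix_rep E H)" using isomorphic_matrix_rep[OF M] .
  obtain m p E' H' where E': "E' \<in> carrier_mat m p" "H' \<in> carrier_mat m p"
    and NE: "isomorphic N (matrix_rep E' H')" using isomorphic_matrix_rep[OF N] .
  have "compression (matrix_rep E H) (matrix_rep E' H')"
    using c isomorphic_imp_compression[OF isomorphic_sym[OF M ME]]
      isomorphic_imp_compression[OF NE] compression_trans by metis
  then have "matrix_succ E H E' H'" by (rule compression_imp_matrix_succ[OF E E'])
  with ME NE show "kronecker_succ M N" unfolding kronecker_succ_def by blast
qed

section \<open>The partial order on isomorphism classes\<close>

lemma iso_classes_mem_iff:
  assumes "X \<in> iso_classes" "M \<in> X"
  shows "N \<in> X \<longleftrightarrow> kronecker_rep M \<and> kronecker_rep N \<and> isomorphic M N"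
proof -
  obtain Z where Z: "X = iso_rel `` {Z}"
    using assms(1) unfolding iso_classes_def by (rule quotientE)
  then have "X = iso_rel `` {M}"
    using equiv_class_eq[OF equiv_iso_rel] assms(2) by blast
  then show ?thesis by (auto simp: iso_rel_def)
qed

lemma iso_classes_rep:
  assumes "X \<in> iso_classes" "M \<in> X"
  shows "kronecker_rep M"
  using iso_classes_mem_iff[OF assms] assms(2) by blast

lemma iso_classes_ex_mem:
  assumes "X \<in> iso_classes"
  obtains M where "M \<in> X"
  using assms in_quotient_imp_non_empty[OF equiv_iso_rel] unfolding iso_classes_def by blast

lemma iso_classes_eqI:
  assumes X: "X \<in> iso_classes" "M \<in> X" and Y: "Y \<in> iso_classes" "N \<in> Y"
    and iso: "isomorphic M N"
  shows "X = Y"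
proof -
  have "(M, N) \<in> iso_rel"
    using iso iso_classes_rep[OF X] iso_classes_rep[OF Y] by (simp add: iso_rel_def)
  then show ?thesis
    using quotient_eqI[OF equiv_iso_rel] X Y unfolding iso_classes_def by blast
qed

text \<open>
  Members of one class compress to each other, and compressions compose, so the witnesses in
  \<open>succ_rel\<close> may be exchanged for the given representatives.
\<close>

lemma succ_rel_iff:
  assumes X: "X \<in> iso_classes" "M \<in> X" and Y: "Y \<in> iso_classes" "N \<in> Y"
  shows "(X, Y) \<in> succ_rel \<longleftrightarrow> compression M N"
proof
  assume "(X, Y) \<in> succ_rel"
  then obtain M' N' where M': "M' \<in> X" and N': "N' \<in> Y" and "kronecker_succ M' N'"
    unfolding succ_rel_def by blast
  then have "compression M' N'"
    using kronecker_succ_iff_compression iso_classes_rep X(1) Y(1) by metis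
  moreover have "compression M M'"
    using iso_classes_mem_iff[OF X] M' by (blast intro: isomorphic_imp_compression)
  moreover have "compression N' N"
    using iso_classes_mem_iff[OF Y(1) N'] Y(2) by (blast intro: isomorphic_imp_compression)
  ultimately show "compression M N" by (metis compression_trans)
next
  assume "compression M N"
  then have "kronecker_succ M N"
    using kronecker_succ_iff_compression iso_classes_rep X Y by metis
  then show "(X, Y) \<in> succ_rel" using X Y unfolding succ_rel_def by blast
qed

lemma partial_order_succ_rel:
  "partial_order_on (iso_classes :: ('k :: field, 'v, 'w) kronecker set set) succ_rel"
  unfolding partial_order_on_def preorder_on_def
proof (intro conjI)
  show sub: "succ_rel \<subseteq> (iso_classes :: ('k, 'v, 'w) kronecker set set) \<times> iso_classes"
    unfolding succ_rel_def by blast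
  show "refl_on (iso_classes :: ('k, 'v, 'w) kronecker set set) succ_rel"
  proof (rule refl_onI)
    fix X :: "('k, 'v, 'w) kronecker set" assume X: "X \<in> iso_classes"
    then obtain M where M: "M \<in> X" by (rule iso_classes_ex_mem)
    have "compression M M"
      using isomorphic_imp_compression[OF isomorphic_refl[OF iso_classes_rep[OF X M]]] .
    with X M show "(X, X) \<in> succ_rel" by (simp add: succ_rel_iff)
  qed
  show "trans (succ_rel :: ('k, 'v, 'w) kronecker set rel)"
  proof (rule transI)
    fix X Y Z :: "('k, 'v, 'w) kronecker set"
    assume XY: "(X, Y) \<in> succ_rel" and YZ: "(Y, Z) \<in> succ_rel"
    then have cls: "X \<in> iso_classes" "Y \<in> iso_classes" "Z \<in> iso_classes" using sub by auto
    obtain L M N where mem: "L \<in> X" "M \<in> Y" "N \<in> Z"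
      using cls by (metis iso_classes_ex_mem)
    have "compression L N"
      using XY YZ cls mem by (metis compression_trans succ_rel_iff)
    with cls mem show "(X, Z) \<in> succ_rel" by (simp add: succ_rel_iff)
  qed
  show "antisym (succ_rel :: ('k, 'v, 'w) kronecker set rel)"
  proof (rule antisymI)
    fix X Y :: "('k, 'v, 'w) kronecker set"
    assume XY: "(X, Y) \<in> succ_rel" and YX: "(Y, X) \<in> succ_rel"
    then have cls: "X \<in> iso_classes" "Y \<in> iso_classes" using sub by auto
    obtain M N where mem: "M \<in> X" "N \<in> Y"
      using cls by (metis iso_classes_ex_mem)
    have "compression M N" "compression N M"
      using XY YX cls mem by (simp_all add: succ_rel_iff)
    then have "isomorphic M N"
      by (rule compression_antisym[OF iso_classes_rep[OF cls(1) mem(1)]])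
    then show "X = Y" by (rule iso_classes_eqI[OF cls(1) mem(1) cls(2) mem(2)])
  qed
qed

theorem proposition1:
  shows "(\<forall>m n p q. \<forall>E H E' H' :: 'k :: field mat.
            E \<in> carrier_mat (m + n) (p + q) \<longrightarrow> H \<in> carrier_mat (m + n) (p + q) \<longrightarrow>
            E' \<in> carrier_mat m p \<longrightarrow> H' \<in> carrier_mat m p \<longrightarrow>
            (matrix_succ E H E' H' \<longleftrightarrow> subfactor (matrix_rep E' H') (matrix_rep E H)))
         \<and> partial_order_on (iso_classes :: ('k, 'v, 'w) kronecker set set) succ_rel"
proof (intro conjI allI impI)
  fix m n p q and E H E' H' :: "'k mat"
  assume E: "E \<in> carrier_mat (m + n) (p + q)" "H \<in> carrier_mat (m + n) (p + q)"
    and E': "E' \<in> carrier_mat m p" "H' \<in> carrier_mat m p"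
  have "subfactor (matrix_rep E' H') (matrix_rep E H) \<longleftrightarrow>
      compression (matrix_rep E H) (matrix_rep E' H')"
    by (rule subfactor_iff_compression[OF kronecker_rep_matrix_rep[OF E]
          kronecker_rep_matrix_rep[OF E']])
  moreover have "matrix_succ E H E' H' \<longleftrightarrow> compression (matrix_rep E H) (matrix_rep E' H')"
    using compression_imp_matrix_succ[OF E E'] matrix_succ_imp_compression by blast
  ultimately show "matrix_succ E H E' H' \<longleftrightarrow> subfactor (matrix_rep E' H') (matrix_rep E H)"
    by simp
qed (rule partial_order_succ_rel)

end
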